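(* Let $\kappa<\lambda$ be cardinals with $\mathrm{cf}(\lambda)<\kappa$ and $2^{<\lambda}=\lambda$. If $U$ is a normal, fine ultrafilter on $P_\kappa(\lambda)$, then $\lnot\mathrm{Gal}(U,\kappa,2^{\lambda^+})$.
   Context: $P_\kappa(\lambda)=\{x\subseteq\lambda : |x|<\kappa\}$. An ultrafilter $U$ on $P_\kappa(\lambda)$ is fine if $\{x\in P_\kappa(\lambda):\alpha\in x\}\in U$ for every $\alpha<\lambda$, and normal if whenever $X_\alpha\in U$ for $\alpha<\lambda$, the diagonal intersection $\triangle_{\alpha<\lambda}X_\alpha=\{x\in P_\kappa(\lambda):\forall\alpha\in x\,(x\in X_\alpha)\}$ is in $U$. For a filter $F$ and cardinals $\mu\le\nu$, $\mathrm{Gal}(F,\mu,\nu)$ means: for every sequence $\langle A_i:i<\nu\rangle$ of sets in $F$ there is $I\subseteq\nu$ with $|I|=\mu$ such that $\bigcap_{i\in I}A_i\in F$.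
   Formalization: The ultrafilter is also assumed κ-complete, as is standard on P_κ(λ); without this the claim can fail: under GCH, with μ supercompact, κ=μ⁺ and λ=μ^{+μ}, lift a normal fine ultrafilter from P_μ(λ) to P_κ(λ). *)

theory Defs
  imports Main
begin

unbundle cardinal_syntax

text \<open>
  A cardinal is a relation satisfying \<^const>\<open>Card_order\<close>; it is identified with the set
  \<^term>\<open>Field r\<close> of its elements, well-ordered by \<^term>\<open>r\<close> in the least possible
  order type.
\<close>

definition least_card :: "'a rel set \<Rightarrow> 'a rel" where
  "least_card R = (SOME r. r \<in> R \<and> (\<forall>r' \<in> R. r \<le>o r'))"

lemma least_card:
  assumes "R \<noteq> {}" "\<forall>r \<in> R. Card_order r"
  shows "least_card R \<in> R" "r \<in> R \<Longrightarrow> least_card R \<le>o r"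
proof -
  have "\<exists>r. r \<in> R \<and> (\<forall>r' \<in> R. r \<le>o r')"
    using exists_minim_Card_order[OF assms] by blast
  from someI_ex[OF this]
  show "least_card R \<in> R" "r \<in> R \<Longrightarrow> least_card R \<le>o r"
    unfolding least_card_def by blast+
qed

text \<open>
  The library's \<^const>\<open>cofinal\<close> asks for strict upper bounds, so it has no instances when there
  is a greatest element. With the non-strict order below, the cofinality is the usual one for
  every cardinal (0 for 0, and 1 for a nonzero finite one).
\<close>

definition cf :: "'a rel \<Rightarrow> 'a rel" where
  "cf r = least_card {|A| | A. A \<subseteq> Field r \<and> (\<forall>a \<in> Field r. \<exists>b \<in> A. (a, b) \<in> r)}"

text \<open>
  \<open>two_pow_less r\<close> is $2^{<r}$, the supremum of all $2^m$ with $m < r$. Each cardinal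
  \<open>m <o r\<close> has a copy on the type of \<open>r\<close>, and the supremum is at most \<open>2^r\<close>, hence
  has a copy on the powerset type, so these types lose nothing.
\<close>

definition two_pow_less :: "'a rel \<Rightarrow> 'a set rel" where
  "two_pow_less r =
    least_card {c. Card_order c \<and> (\<forall>m :: 'a rel. Card_order m \<and> m <o r \<longrightarrow> ctwo ^c m \<le>o c)}"

definition Pk :: "'k rel \<Rightarrow> 'a rel \<Rightarrow> 'a set set" where
  "Pk k l = {x. x \<subseteq> Field l \<and> |x| <o k}"

text \<open>
  A filter on a set \<open>S\<close> is rendered as a \<^typ>\<open>'x filter\<close> below \<^term>\<open>principal S\<close>;
  a set \<open>X\<close> belongs to it iff \<open>\<forall>\<^sub>F x in F. x \<in> X\<close>.
\<close>

definition ultrafilter_on :: "'x set \<Rightarrow> 'x filter \<Rightarrow> bool" where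
  "ultrafilter_on S U \<longleftrightarrow> U \<le> principal S \<and> U \<noteq> bot \<and>
    (\<forall>X \<subseteq> S. (\<forall>\<^sub>F x in U. x \<in> X) \<or> (\<forall>\<^sub>F x in U. x \<in> S - X))"

text \<open>
  Completeness is part of the usual meaning of a normal fine ultrafilter on $P_\kappa(\lambda)$ and
  is kept as a separate condition because \<open>fine\<close> and \<open>normal\<close> below do not imply it: a normal
  fine ultrafilter on $P_{\mu}(\lambda)$ with $\mu < \kappa$ generates an ultrafilter on $P_\kappa(\lambda)$
  satisfying both.
\<close>

definition complete_filter :: "'k rel \<Rightarrow> 'x filter \<Rightarrow> bool" where
  "complete_filter k F \<longleftrightarrow>
    (\<forall>\<X> :: 'x set set. |\<X>| <o k \<and> (\<forall>X \<in> \<X>. \<forall>\<^sub>F x in F. x \<in> X) \<longrightarrow> (\<forall>\<^sub>F x in F. x \<in> \<Inter>\<X>))"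

definition fine :: "'a rel \<Rightarrow> 'a set filter \<Rightarrow> bool" where
  "fine l U \<longleftrightarrow> (\<forall>a \<in> Field l. \<forall>\<^sub>F x in U. a \<in> x)"

definition diag_inter :: "'k rel \<Rightarrow> 'a rel \<Rightarrow> ('a \<Rightarrow> 'a set set) \<Rightarrow> 'a set set" where
  "diag_inter k l X = {x \<in> Pk k l. \<forall>a \<in> x. x \<in> X a}"

definition normal :: "'k rel \<Rightarrow> 'a rel \<Rightarrow> 'a set filter \<Rightarrow> bool" where
  "normal k l U \<longleftrightarrow>
    (\<forall>X. (\<forall>a \<in> Field l. \<forall>\<^sub>F x in U. x \<in> X a) \<longrightarrow> (\<forall>\<^sub>F x in U. x \<in> diag_inter k l X))"

definition Gal :: "'x filter \<Rightarrow> 'm rel \<Rightarrow> 'n rel \<Rightarrow> bool" where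
  "Gal F \<mu> \<nu> \<longleftrightarrow>
    (\<forall>A :: 'n \<Rightarrow> 'x set. (\<forall>i \<in> Field \<nu>. \<forall>\<^sub>F x in F. x \<in> A i) \<longrightarrow>
      (\<exists>I \<subseteq> Field \<nu>. |I| =o \<mu> \<and> (\<forall>\<^sub>F x in F. x \<in> (\<Inter>i \<in> I. A i))))"

end

theory Submission
  imports Defs
begin

text \<open>
  Since \<open>2\<^sup>m \<le> l\<close> for all \<open>m < l\<close> and \<open>cf l < k\<close>, there are injections from the subsets of \<open>l\<close>, and hence from
  the points of \<open>l\<^sup>+\<close> and from the subsets of each \<open>a < l\<^sup>+\<close>, to subsets of \<open>l\<close> of size at most \<open>cf l\<close>.
  For \<open>S \<subseteq> l\<^sup>+\<close> let \<open>W S\<close> be the set of those \<open>x\<close> such that for all \<open>a < l\<^sup>+\<close>, if \<open>x\<close> includes the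
  code of \<open>a\<close> then \<open>x\<close> includes the code of \<open>S \<inter> a\<close>; by normality and completeness \<open>W S\<close> is in \<open>U\<close>.
  If \<open>I\<close> consists of \<open>k\<close> sets \<open>S\<close>, then they are already distinct below a single \<open>a < l\<^sup>+\<close>. Were the
  intersection of the \<open>W S\<close> in \<open>U\<close>, almost every \<open>x\<close> would have \<open>k\<close> many subsets, which is
  impossible because \<open>|x| < k\<close> and \<open>k\<close> is a strong limit.
\<close>

section \<open>Cardinal arithmetic from \<open>two_pow_less\<close> and cofinality\<close>

lemma card_of_Pow_ctwo: "|Pow A| =o ctwo ^c |A|"
  using card_of_Pow_Func[of A] by (simp add: cexp_def Field_card_of ctwo_def)

text \<open>The powerset of the whole type bounds every \<open>ctwo ^c m\<close>, so the family
  minimised in \<open>two_pow_less\<close> is nonempty and its minimum is itself an upper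
  bound.\<close>

lemma ctwo_cexp_le_two_pow_less:
  fixes r m :: "'a rel"
  assumes "Card_order m" "m <o r"
  shows "ctwo ^c m \<le>o two_pow_less r"
proof -
  let ?R = "{c :: 'a set rel. Card_order c \<and>
    (\<forall>m :: 'a rel. Card_order m \<and> m <o r \<longrightarrow> ctwo ^c m \<le>o c)}"
  have "ctwo ^c m \<le>o |UNIV :: 'a set set|" if "Card_order m" for m :: "'a rel"
  proof -
    have "ctwo ^c m =o |Pow (Field m)|"
      using card_of_Pow_Func[of "Field m"]
      by (simp add: cexp_def Field_card_of ctwo_def ordIso_symmetric)
    also have "|Pow (Field m)| \<le>o |UNIV :: 'a set set|" by (rule card_of_mono1) simp
    finally show ?thesis .
  qed
  then have "|UNIV :: 'a set set| \<in> ?R" by (simp add: card_of_Card_order)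
  then have "least_card ?R \<in> ?R" by (intro least_card(1)) auto
  then show ?thesis using assms by (simp add: two_pow_less_def)
qed

lemma Pow_le_of_two_pow_less:
  fixes l :: "'a rel" and B :: "'a set"
  assumes "two_pow_less l =o l" "|B| <o l"
  shows "|Pow B| \<le>o l"
proof -
  have "|Pow B| =o ctwo ^c |B|" by (rule card_of_Pow_ctwo)
  also have "ctwo ^c |B| \<le>o two_pow_less l"
    using assms(2) by (intro ctwo_cexp_le_two_pow_less card_of_Card_order)
  also have "two_pow_less l =o l" by fact
  finally show ?thesis .
qed

lemma cf_witness:
  assumes "Card_order l"
  obtains A where "A \<subseteq> Field l" "\<And>a. a \<in> Field l \<Longrightarrow> \<exists>b \<in> A. (a, b) \<in> l" "cf l = |A|"
proof -
  let ?R = "{|A| | A. A \<subseteq> Field l \<and> (\<forall>a \<in> Field l. \<exists>b \<in> A. (a, b) \<in> l)}"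
  have "refl_on (Field l) l"
    using assms unfolding card_order_on_def well_order_on_def linear_order_on_def
      partial_order_on_def preorder_on_def by blast
  then have "\<forall>a \<in> Field l. \<exists>b \<in> Field l. (a, b) \<in> l" by (auto dest: refl_onD)
  then have "|Field l| \<in> ?R" by blast
  then have "least_card ?R \<in> ?R" by (intro least_card(1)) (auto simp: card_of_Card_order)
  then show ?thesis using that unfolding cf_def by blast
qed

lemma finite_card_of_less_iff:
  assumes "finite B"
  shows "|A| <o |B| \<longleftrightarrow> finite A \<and> card A < card B"
proof -
  have "finite A" if "|A| <o |B|"
    using assms that card_of_ordLeq_finite ordLess_imp_ordLeq by blast
  moreover have "|A| <o |B| \<longleftrightarrow> card A < card B" if "finite A"
    using inj_on_iff_card_le[OF assms that] card_of_ordLess[of B A] by (simp add: not_le)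
  ultimately show ?thesis by blast
qed

text \<open>If \<open>l\<close> had finite size \<open>n\<close>, a cofinal set would be nonempty,
  so \<open>n \<ge> 3\<close>; but then \<open>n - 1\<close> elements already have more than
  \<open>n\<close> subsets.\<close>

lemma infinite_of_two_pow_less:
  fixes l :: "'a rel" and k :: "'k rel"
  assumes k: "Card_order k" and l: "Card_order l"
    and "k <o l" "cf l <o k" and pow: "two_pow_less l =o l"
  shows "infinite (Field l)"
proof
  assume fin: "finite (Field l)"
  obtain A where A: "A \<subseteq> Field l" "\<And>a. a \<in> Field l \<Longrightarrow> \<exists>b \<in> A. (a, b) \<in> l" "cf l = |A|"
    using cf_witness[OF l] by blast
  have lf: "|Field l| =o l" and kf: "|Field k| =o k"
    using k l by (auto intro: card_of_Field_ordIso)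
  have "|Field k| <o |Field l|"
    using kf lf assms(3) ordIso_ordLess_trans ordLess_ordIso_trans ordIso_symmetric by blast
  then have kl: "finite (Field k)" "card (Field k) < card (Field l)"
    by (simp_all add: finite_card_of_less_iff fin)
  have "|A| <o |Field k|"
    using A(3) assms(4) kf ordLess_ordIso_trans ordIso_symmetric by metis
  then have Ak: "finite A" "card A < card (Field k)"
    by (simp_all add: finite_card_of_less_iff kl)
  obtain z where z: "z \<in> Field l" using kl by fastforce
  then have "card A > 0" using A(2) Ak(1) card_gt_0_iff by blast
  then have n: "card (Field l) \<ge> 3" using Ak kl by linarith
  let ?M = "Field l - {z}"
  have M: "card ?M = card (Field l) - 1" using z by simp
  have "|?M| <o |Field l|" using fin n M by (simp add: finite_card_of_less_iff)
  then have "|Pow ?M| \<le>o l"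
    using lf by (intro Pow_le_of_two_pow_less[OF pow]) (rule ordLess_ordIso_trans)
  then have "|Pow ?M| \<le>o |Field l|" using lf ordIso_symmetric ordLeq_ordIso_trans by blast
  then have "card (Pow ?M) \<le> card (Field l)"
    using fin card_of_ordLeq[of "Pow ?M" "Field l"] inj_on_iff_card_le[of "Pow ?M" "Field l"] by simp
  then have le: "2 ^ (card (Field l) - 1) \<le> card (Field l)" using fin M by (simp add: card_Pow)
  obtain m where m: "card (Field l) = m + 3" using n le_Suc_ex by (metis add.commute)
  have "m + 3 < 2 ^ (m + 2)" by (induction m) auto
  then show False using le m by simp
qed

section \<open>Coding subsets of \<open>l\<close> by small sets\<close>

lemma inj_into_Field:
  assumes "Card_order l" "|A| \<le>o l"
  obtains f where "inj_on f A" "f ` A \<subseteq> Field l"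
proof -
  have "|A| \<le>o |Field l|"
    using assms card_of_Field_ordIso ordIso_symmetric ordLeq_ordIso_trans by blast
  then show ?thesis using that card_of_ordLeq[of A "Field l"] by blast
qed

text \<open>
  A subset \<open>X\<close> of \<open>l\<close> is coded by its initial segments below a cofinal set \<open>A\<close>; each segment is
  coded by a single element of \<open>l\<close> because \<open>2\<^sup>m \<le> l\<close> for \<open>m < l\<close>.
\<close>

lemma code_subsets:
  fixes l :: "'a rel"
  assumes l: "Card_order l" and inf: "infinite (Field l)" and pow: "two_pow_less l =o l"
    and A: "A \<subseteq> Field l" and cof: "\<And>a. a \<in> Field l \<Longrightarrow> \<exists>b \<in> A. (a, b) \<in> l"
  obtains C :: "'a set \<Rightarrow> 'a \<Rightarrow> 'a"
  where "inj_on (\<lambda>X. C X ` A) (Pow (Field l))" "\<And>X. C X ` A \<subseteq> Field l"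
proof -
  have "\<exists>p. inj_on p (Pow (underS l a)) \<and> p ` Pow (underS l a) \<subseteq> Field l" if "a \<in> A" for a
    by (rule inj_into_Field[OF l Pow_le_of_two_pow_less[OF pow card_of_underS[OF l]]])
      (use that A in auto)
  then obtain p where p: "\<And>a. a \<in> A \<Longrightarrow> inj_on (p a) (Pow (underS l a))"
    "\<And>a. a \<in> A \<Longrightarrow> p a ` Pow (underS l a) \<subseteq> Field l" by metis
  obtain g where g: "inj_on g (Field l \<times> Field l)" "g ` (Field l \<times> Field l) \<subseteq> Field l"
    using inj_into_Field[OF l Card_order_Times_same_infinite[OF l inf]] by blast
  obtain z where z: "z \<in> Field l" using inf by fastforce
  \<comment> \<open>The pair carries \<open>a\<close> along, so the unordered image of
    \<open>A\<close> under \<open>C X\<close> still determines each segment of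
    \<open>X\<close>.\<close>
  define C where "C X a = (if a \<in> A then g (a, p a (X \<inter> underS l a)) else z)" for X a
  have seg: "(a, p a (X \<inter> underS l a)) \<in> Field l \<times> Field l" if "a \<in> A" for X a
    using p(2)[OF that] that A by blast
  have sub: "X \<subseteq> Y" if eq: "C X ` A = C Y ` A" and X: "X \<subseteq> Field l" for X Y
  proof
    fix b assume "b \<in> X"
    then have "b \<in> Field l" using X by blast
    \<comment> \<open>Cofinality gives only a non-strict bound, so \<open>b\<close> is first raised
      to \<open>c\<close> in order to lie strictly below some \<open>a\<close> in
      \<open>A\<close>.\<close>
    then obtain c where c: "c \<in> Field l" "b \<noteq> c" "(b, c) \<in> l"
      using infinite_Card_order_limit[OF l inf] by blast
    obtain a where a: "a \<in> A" "(c, a) \<in> l" using cof c by blast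
    have "trans l" "antisym l"
      using l unfolding card_order_on_def well_order_on_def linear_order_on_def
        partial_order_on_def preorder_on_def by blast+
    then have ba: "b \<in> underS l a"
      using a c unfolding underS_def by (auto dest: transD antisymD)
    obtain a' where "a' \<in> A" "C X a = C Y a'" using eq a by blast
    then have "(a, p a (X \<inter> underS l a)) = (a', p a' (Y \<inter> underS l a'))"
      using a(1) by (intro inj_onD[OF g(1)] seg) (simp_all add: C_def)
    then have "X \<inter> underS l a = Y \<inter> underS l a"
      using inj_onD[OF p(1)[OF a(1)]] by auto
    then show "b \<in> Y" using ba \<open>b \<in> X\<close> by blast
  qed
  show ?thesis
  proof
    show "inj_on (\<lambda>X. C X ` A) (Pow (Field l))"
      by (rule inj_onI) (metis sub PowD subset_antisym)
    show "C X ` A \<subseteq> Field l" for X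
      using seg g(2) z by (auto simp: C_def)
  qed
qed

section \<open>Consequences of normality, completeness and fineness\<close>

lemma ultrafilter_on_eventually_mem:
  assumes "ultrafilter_on S U"
  shows "\<forall>\<^sub>F x in U. x \<in> S"
  using assms unfolding ultrafilter_on_def le_principal by blast

lemma ultrafilter_on_cases:
  assumes "ultrafilter_on S U"
  shows "(\<forall>\<^sub>F x in U. P x) \<or> (\<forall>\<^sub>F x in U. \<not> P x)"
proof -
  have "(\<forall>\<^sub>F x in U. x \<in> {x \<in> S. P x}) \<or> (\<forall>\<^sub>F x in U. x \<in> S - {x \<in> S. P x})"
    using assms[unfolded ultrafilter_on_def, THEN conjunct2, THEN conjunct2, THEN spec,
        of "{x \<in> S. P x}", THEN mp] by simp
  then show ?thesis
  proof
    assume "\<forall>\<^sub>F x in U. x \<in> {x \<in> S. P x}"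
    then have "\<forall>\<^sub>F x in U. P x" by (rule eventually_mono) blast
    then show ?thesis ..
  next
    assume "\<forall>\<^sub>F x in U. x \<in> S - {x \<in> S. P x}"
    with ultrafilter_on_eventually_mem[OF assms] have "\<forall>\<^sub>F x in U. \<not> P x"
      by eventually_elim blast
    then show ?thesis ..
  qed
qed

text \<open>Holds because \<open>U\<close> is proper; it turns a contradiction at almost every point
  into an outright one.\<close>

lemma ultrafilter_on_const:
  assumes "ultrafilter_on S U" "\<forall>\<^sub>F x in U. P"
  shows P
  using assms by (cases P) (simp_all add: ultrafilter_on_def eventually_False)

lemma eventually_choice:
  assumes "\<forall>\<^sub>F x in F. \<exists>y. P x y"
  obtains f where "\<forall>\<^sub>F x in F. P x (f x)"
proof
  show "\<forall>\<^sub>F x in F. P x (SOME y. P x y)" using assms by (rule eventually_mono) (rule someI_ex)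
qed

lemma complete_filter_ball:
  assumes "complete_filter k F" "|B| <o k" "\<And>b. b \<in> B \<Longrightarrow> \<forall>\<^sub>F x in F. P b x"
  shows "\<forall>\<^sub>F x in F. \<forall>b \<in> B. P b x"
proof -
  let ?X = "(\<lambda>b. {x. P b x}) ` B"
  have "|?X| <o k" using card_of_image assms(2) by (rule ordLeq_ordLess_trans)
  moreover have "\<forall>X \<in> ?X. \<forall>\<^sub>F x in F. x \<in> X" using assms(3) by simp
  ultimately have "\<forall>\<^sub>F x in F. x \<in> \<Inter>?X" using assms(1) unfolding complete_filter_def by blast
  then show ?thesis by simp
qed

lemma fine_complete_subset:
  assumes "complete_filter k U" "fine l U" "y \<subseteq> Field l" "|y| <o k"
  shows "\<forall>\<^sub>F x in U. y \<subseteq> x"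
  using complete_filter_ball[OF assms(1,4), of "\<lambda>b x. b \<in> x"] assms(2,3)
  unfolding fine_def subset_eq by blast

text \<open>If every value were avoided almost everywhere, almost every \<open>x\<close> would lie
  in the diagonal intersection of the avoiding sets, and \<open>f x\<close>, being a member of
  \<open>x\<close>, would differ from itself.\<close>

lemma normal_press_down:
  assumes U: "ultrafilter_on (Pk k l) U" "normal k l U" and f: "\<forall>\<^sub>F x in U. f x \<in> x"
  obtains a where "a \<in> Field l" "\<forall>\<^sub>F x in U. f x = a"
proof (rule ccontr)
  assume "\<not> thesis"
  then have "\<forall>a \<in> Field l. \<forall>\<^sub>F x in U. x \<in> {x. f x \<noteq> a}"
    using that ultrafilter_on_cases[OF U(1)] by fastforce
  then have "\<forall>\<^sub>F x in U. x \<in> diag_inter k l (\<lambda>a. {x. f x \<noteq> a})"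
    using U(2)[unfolded normal_def, rule_format, of "\<lambda>a. {x. f x \<noteq> a}"] by blast
  with f have "\<forall>\<^sub>F x in U. False"
    by eventually_elim (auto simp: diag_inter_def)
  then show False by (rule ultrafilter_on_const[OF U(1)])
qed

text \<open>
  Otherwise counterexamples \<open>h x\<close> can be chosen for almost all \<open>x\<close>. Pressing down at each \<open>b \<in> B\<close> and
  then using completeness makes \<open>h x\<close> constant on \<open>B\<close>.
\<close>

lemma normal_diag_image:
  assumes U: "ultrafilter_on (Pk k l) U" "normal k l U" "complete_filter k U" and B: "|B| <o k"
    and X: "\<And>h. h ` B \<subseteq> Field l \<Longrightarrow> \<forall>\<^sub>F x in U. x \<in> X (h ` B)"
  shows "\<forall>\<^sub>F x in U. \<forall>h. h ` B \<subseteq> x \<longrightarrow> x \<in> X (h ` B)"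
proof (rule ccontr)
  assume "\<not> ?thesis"
  then have "\<forall>\<^sub>F x in U. \<exists>h. h ` B \<subseteq> x \<and> x \<notin> X (h ` B)"
    using ultrafilter_on_cases[OF U(1), of "\<lambda>x. \<forall>h. h ` B \<subseteq> x \<longrightarrow> x \<in> X (h ` B)"] by simp
  then obtain h where ev: "\<forall>\<^sub>F x in U. h x ` B \<subseteq> x \<and> x \<notin> X (h x ` B)"
    by (rule eventually_choice)
  have "\<exists>a. a \<in> Field l \<and> (\<forall>\<^sub>F x in U. h x b = a)" if "b \<in> B" for b
  proof -
    have "\<forall>\<^sub>F x in U. h x b \<in> x" using ev by (rule eventually_mono) (use that in blast)
    then show ?thesis by (metis normal_press_down[OF U(1,2)])
  qed
  then obtain g where g: "\<And>b. b \<in> B \<Longrightarrow> g b \<in> Field l"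
    "\<And>b. b \<in> B \<Longrightarrow> \<forall>\<^sub>F x in U. h x b = g b" by metis
  have "\<forall>\<^sub>F x in U. \<forall>b \<in> B. h x b = g b" using complete_filter_ball[OF U(3) B g(2)] .
  moreover have "\<forall>\<^sub>F x in U. x \<in> X (g ` B)" using g(1) by (intro X) blast
  ultimately have "\<forall>\<^sub>F x in U. False"
    using ev
  proof eventually_elim
    case (elim x)
    then have "h x ` B = g ` B" by auto
    with elim show False by simp
  qed
  then show False by (rule ultrafilter_on_const[OF U(1)])
qed

text \<open>
  Otherwise \<open>k\<close> many points of \<open>l\<close> inject into \<open>Pow B\<close>. The image of a chosen one of these points omitted
  by \<open>x\<close> is decided at each \<open>b \<in> B\<close>, hence constant by completeness, contradicting fineness.
\<close>

lemma Pow_less_of_complete_fine: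
  assumes k: "Card_order k" and l: "Card_order l" "k <o l"
    and U: "ultrafilter_on (Pk k l) U" "complete_filter k U" "fine l U" and B: "|B| <o k"
  shows "|Pow B| <o k"
proof (rule ccontr)
  have kf: "|Field k| =o k" using k by (rule card_of_Field_ordIso)
  assume "\<not> ?thesis"
  then have "k \<le>o |Pow B|" using k card_of_Card_order
    by (metis not_ordLess_iff_ordLeq card_order_on_well_order_on)
  with kf have "|Field k| \<le>o |Pow B|" by (rule ordIso_ordLeq_trans)
  then obtain F where F: "inj_on F (Field k)" "F ` Field k \<subseteq> Pow B"
    unfolding card_of_ordLeq[symmetric] by blast
  have "|Field k| \<le>o l" using kf l(2) ordIso_ordLess_trans ordLess_imp_ordLeq by blast
  then obtain e where e: "inj_on e (Field k)" "e ` Field k \<subseteq> Field l"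
    by (rule inj_into_Field[OF l(1)])
  have "\<forall>\<^sub>F x in U. x \<in> Pk k l" by (rule ultrafilter_on_eventually_mem[OF U(1)])
  then have "\<forall>\<^sub>F x in U. \<exists>i. i \<in> Field k \<and> e i \<notin> x"
  proof eventually_elim
    case (elim x)
    then have "|x| <o k" by (simp add: Pk_def)
    then have "|x| <o |Field k|" using kf ordIso_symmetric ordLess_ordIso_trans by blast
    then show ?case using e(1) card_of_ordLess[of "Field k" x] by blast
  qed
  then obtain \<rho> where \<rho>: "\<forall>\<^sub>F x in U. \<rho> x \<in> Field k \<and> e (\<rho> x) \<notin> x"
    by (rule eventually_choice)
  define Z where "Z = {b \<in> B. \<forall>\<^sub>F x in U. b \<in> F (\<rho> x)}"
  have "\<forall>\<^sub>F x in U. b \<in> F (\<rho> x) \<longleftrightarrow> b \<in> Z" if "b \<in> B" for b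
    using ultrafilter_on_cases[OF U(1), of "\<lambda>x. b \<in> F (\<rho> x)"] that
    by (cases "b \<in> Z") (auto simp: Z_def)
  then have "\<forall>\<^sub>F x in U. \<forall>b \<in> B. b \<in> F (\<rho> x) \<longleftrightarrow> b \<in> Z"
    by (rule complete_filter_ball[OF U(2) B])
  with \<rho> have Z: "\<forall>\<^sub>F x in U. \<rho> x \<in> Field k \<and> e (\<rho> x) \<notin> x \<and> F (\<rho> x) = Z"
  proof eventually_elim
    case (elim x)
    moreover have "Z \<subseteq> B" by (auto simp: Z_def)
    ultimately show ?case using F(2) by blast
  qed
  \<comment> \<open>The claim no longer depends on \<open>x\<close>, so a fixed \<open>i\<close> has
    \<open>F i = Z\<close>. Injectivity of \<open>F\<close> forces \<open>\<rho> x = i\<close>, so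
    almost every \<open>x\<close> omits \<open>e i\<close>.\<close>
  have "\<forall>\<^sub>F x in U. \<exists>i \<in> Field k. F i = Z" using Z by (rule eventually_mono) blast
  then obtain i where i: "i \<in> Field k" "F i = Z" using ultrafilter_on_const[OF U(1)] by blast
  have "\<forall>\<^sub>F x in U. e i \<in> x" using U(3) e(2) i unfolding fine_def by blast
  with Z have "\<forall>\<^sub>F x in U. False"
    by eventually_elim (use i F(1) in \<open>auto dest: inj_onD\<close>)
  then show False by (rule ultrafilter_on_const[OF U(1)])
qed

section \<open>Boundedness below the successor of \<open>l\<close>\<close>

lemma cardSuc_bounded:
  assumes l: "Card_order l" "infinite (Field l)" and D: "D \<subseteq> Field (cardSuc l)" "|D| \<le>o l"
  obtains a where "a \<in> Field (cardSuc l)" "D \<subseteq> underS (cardSuc l) a"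
proof -
  let ?s = "cardSuc l"
  have s: "Card_order ?s" "infinite (Field ?s)" using l by (simp_all add: cardSuc_Card_order cardSuc_finite)
  have "trans ?s" "antisym ?s"
    using s(1) unfolding card_order_on_def well_order_on_def linear_order_on_def
      partial_order_on_def preorder_on_def by blast+
  \<comment> \<open>The initial segments form an increasing cover of \<open>D\<close>; by regularity
    of the successor, one of them contains \<open>D\<close>.\<close>
  then have "relChain ?s (underS ?s)"
    unfolding relChain_def underS_def by (blast dest: transD antisymD)
  moreover have "D \<subseteq> (\<Union>i \<in> Field ?s. underS ?s i)"
    using D(1) infinite_Card_order_limit[OF s] unfolding underS_def by fastforce
  ultimately show ?thesis using cardSuc_UNION[OF l _ _ D(2)] that by blast
qed

text \<open>One point of difference is chosen for each pair from \<open>I\<close>; these are at most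
  \<open>l\<close> many points, hence bounded below the successor.\<close>

lemma separating_bound:
  assumes l: "Card_order l" "infinite (Field l)"
    and I: "I \<subseteq> Func (Field (cardSuc l)) UNIV" "|I| \<le>o l"
  obtains a where "a \<in> Field (cardSuc l)"
    "\<And>S T. S \<in> I \<Longrightarrow> T \<in> I \<Longrightarrow> (\<And>d. d \<in> underS (cardSuc l) a \<Longrightarrow> S d = T d) \<Longrightarrow> S = T"
proof -
  have "\<exists>d \<in> Field (cardSuc l). S \<noteq> T \<longrightarrow> S d \<noteq> T d" if "S \<in> I" "T \<in> I" for S T
  proof -
    \<comment> \<open>Members of \<open>Func\<close> share one default value off the domain, so
      distinct ones differ inside it.\<close>
    have "S d = T d" if "d \<notin> Field (cardSuc l)" for d
      using subsetD[OF I(1) \<open>S \<in> I\<close>] subsetD[OF I(1) \<open>T \<in> I\<close>] that by (simp add: Func_def)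
    moreover have "Field (cardSuc l) \<noteq> {}" using l by (simp add: Field_cardSuc_not_empty)
    ultimately show ?thesis
      by (cases "S = T") (blast, blast intro: ext)
  qed
  then obtain \<delta> where \<delta>: "\<And>S T. S \<in> I \<Longrightarrow> T \<in> I \<Longrightarrow> \<delta> S T \<in> Field (cardSuc l)"
    "\<And>S T. S \<in> I \<Longrightarrow> T \<in> I \<Longrightarrow> S \<noteq> T \<Longrightarrow> S (\<delta> S T) \<noteq> T (\<delta> S T)" by metis
  define D where "D = (\<lambda>(S, T). \<delta> S T) ` (I \<times> I)"
  obtain e where e: "inj_on e I" "e ` I \<subseteq> Field l" using inj_into_Field[OF l(1) I(2)] .
  have "|D| \<le>o |I \<times> I|" unfolding D_def by (rule card_of_image)
  also have "|I \<times> I| \<le>o |Field l \<times> Field l|"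
    by (rule card_of_ordLeqI[OF map_prod_inj_on[OF e(1) e(1)]]) (use e(2) in \<open>auto simp: image_subset_iff\<close>)
  also have "|Field l \<times> Field l| \<le>o l" by (rule Card_order_Times_same_infinite[OF l])
  finally have "|D| \<le>o l" .
  moreover have "D \<subseteq> Field (cardSuc l)" using \<delta>(1) by (auto simp: D_def)
  ultimately obtain a where "a \<in> Field (cardSuc l)" "D \<subseteq> underS (cardSuc l) a"
    using cardSuc_bounded[OF l] by blast
  moreover from this(2) have "\<delta> S T \<in> underS (cardSuc l) a" if "S \<in> I" "T \<in> I" for S T
    using that unfolding D_def by blast
  ultimately show ?thesis using that \<delta>(2) by blast
qed

section \<open>The sets \<open>W S\<close> refute the Galvin property\<close>

theorem theorem2p14:
  fixes k :: "'k rel" and l :: "'a rel" and U :: "'a set filter"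
  assumes "Card_order k" and "Card_order l" and "k <o l"
    and "cf l <o k"
    and "two_pow_less l =o l"
    and "ultrafilter_on (Pk k l) U" and "complete_filter k U"
    and "normal k l U" and "fine l U"
  shows "\<not> Gal U k (ctwo ^c cardSuc l)"
proof
  let ?s = "cardSuc l"
  assume Gal: "Gal U k (ctwo ^c ?s)"
  have inf: "infinite (Field l)" using infinite_of_two_pow_less assms(1-5) by blast
  obtain A where A: "A \<subseteq> Field l" "\<And>a. a \<in> Field l \<Longrightarrow> \<exists>b \<in> A. (a, b) \<in> l" "cf l = |A|"
    using cf_witness[OF assms(2)] by blast
  obtain C where C: "inj_on (\<lambda>X. C X ` A) (Pow (Field l))" "\<And>X. C X ` A \<subseteq> Field l"
    using code_subsets[OF assms(2) inf assms(5) A(1,2)] by blast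
  have Ak: "|A| <o k" using A(3) assms(4) by simp
  have s: "Card_order ?s" by (simp add: assms(2) cardSuc_Card_order)
  have "?s \<le>o |Pow (Field l)|"
    using assms(2) by (intro cardSuc_least card_of_Card_order Card_order_Pow)
  with card_of_Field_ordIso[OF s] have "|Field ?s| \<le>o |Pow (Field l)|" by (rule ordIso_ordLeq_trans)
  then obtain e where e: "inj_on e (Field ?s)" "e ` Field ?s \<subseteq> Pow (Field l)"
    unfolding card_of_ordLeq[symmetric] by blast
  have "\<exists>q. inj_on q (underS ?s a) \<and> q ` underS ?s a \<subseteq> Field l" if "a \<in> Field ?s" for a
  proof -
    have "|underS ?s a| \<le>o l"
      using card_of_underS[OF s that] cardSuc_ordLeq_ordLess[OF assms(2) card_of_Card_order] by blast
    then show ?thesis by (metis inj_into_Field[OF assms(2)])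
  qed
  then obtain q where q: "\<And>a. a \<in> Field ?s \<Longrightarrow> inj_on (q a) (underS ?s a)"
    "\<And>a. a \<in> Field ?s \<Longrightarrow> q a ` underS ?s a \<subseteq> Field l" by metis
  \<comment> \<open>\<open>S\<close> is a characteristic function; \<open>q a\<close> moves its part
    below \<open>a\<close> into \<open>l\<close>, where \<open>C\<close> codes it.\<close>
  define code where "code a S = C (q a ` {d \<in> underS ?s a. S d}) ` A" for a and S :: "'a set \<Rightarrow> bool"
  define W where "W S = {x. \<forall>a \<in> Field ?s. C (e a) ` A \<subseteq> x \<longrightarrow> code a S \<subseteq> x}" for S
  \<comment> \<open>A code has at most \<open>cf l\<close> points, fewer than
    \<open>k\<close>.\<close>
  have small: "\<forall>\<^sub>F x in U. C X ` A \<subseteq> x" for X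
    using C(2) card_of_image Ak
    by (blast intro: fine_complete_subset[OF assms(7,9)] ordLeq_ordLess_trans)
  have "\<forall>\<^sub>F x in U. x \<in> W S" for S
  proof -
    \<comment> \<open>Indexing by the code \<open>y\<close> instead of \<open>a\<close> fits
      \<open>normal_diag_image\<close>; by injectivity at most one \<open>a\<close> has code
      \<open>y\<close>.\<close>
    define X where "X y = {x. \<forall>a \<in> Field ?s. C (e a) ` A = y \<longrightarrow> code a S \<subseteq> x}" for y
    have "\<forall>\<^sub>F x in U. x \<in> X y" for y
    proof (cases "\<exists>a \<in> Field ?s. C (e a) ` A = y")
      case True
      then obtain a where a: "a \<in> Field ?s" "C (e a) ` A = y" by blast
      have "a' = a" if "a' \<in> Field ?s" "C (e a') ` A = y" for a'
        using inj_onD[OF C(1), of "e a'" "e a"] inj_onD[OF e(1)] e(2) a that by blast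
      then have "x \<in> X y" if "code a S \<subseteq> x" for x using that unfolding X_def by blast
      then show ?thesis
        unfolding code_def by (rule eventually_mono[OF small])
    qed (simp add: X_def)
    then have "\<forall>\<^sub>F x in U. \<forall>h. h ` A \<subseteq> x \<longrightarrow> x \<in> X (h ` A)"
      by (intro normal_diag_image[OF assms(6,8,7) Ak])
    then show ?thesis by (rule eventually_mono) (auto simp: W_def X_def)
  qed
  then obtain I where I: "I \<subseteq> Field (ctwo ^c ?s)" "|I| =o k" "\<forall>\<^sub>F x in U. x \<in> (\<Inter>S \<in> I. W S)"
    using Gal unfolding Gal_def by blast
  have "I \<subseteq> Func (Field ?s) UNIV" using I(1) by (simp add: cexp_def Field_card_of ctwo_def)
  moreover have "|I| \<le>o l" using I(2) assms(3) ordIso_ordLess_trans ordLess_imp_ordLeq by blast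
  ultimately obtain a where a: "a \<in> Field ?s"
    "\<And>S T. S \<in> I \<Longrightarrow> T \<in> I \<Longrightarrow> (\<And>d. d \<in> underS ?s a \<Longrightarrow> S d = T d) \<Longrightarrow> S = T"
    using separating_bound[OF assms(2) inf] by blast
  have inj: "inj_on (code a) I"
  proof (rule inj_onI)
    fix S T assume ST: "S \<in> I" "T \<in> I" "code a S = code a T"
    then have "q a ` {d \<in> underS ?s a. S d} = q a ` {d \<in> underS ?s a. T d}"
      using inj_onD[OF C(1), OF ST(3)[unfolded code_def]] q(2)[OF a(1)] by blast
    then have "{d \<in> underS ?s a. S d} = {d \<in> underS ?s a. T d}"
      by (subst (asm) inj_on_image_eq_iff[OF q(1)[OF a(1)]]) auto
    then show "S = T" by (intro a(2) ST) blast
  qed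
  have "\<forall>\<^sub>F x in U. x \<in> Pk k l" by (rule ultrafilter_on_eventually_mem[OF assms(6)])
  with I(3) small[of "e a"] have "\<forall>\<^sub>F x in U. False"
  proof eventually_elim
    case (elim x)
    \<comment> \<open>As \<open>x\<close> includes the code of \<open>a\<close> and lies in every
      \<open>W S\<close>, it includes the \<open>k\<close> many distinct sets
      \<open>code a S\<close>.\<close>
    have "code a ` I \<subseteq> Pow x" using elim(1,2) a(1) by (auto simp: W_def)
    then have "|I| \<le>o |Pow x|" by (intro card_of_ordLeqI[OF inj]) blast
    also have "|Pow x| <o k"
      using elim(3) by (intro Pow_less_of_complete_fine[OF assms(1-3,6,7,9)]) (simp add: Pk_def)
    finally show False using I(2) not_ordLess_ordIso by blast
  qed
  then show False by (rule ultrafilter_on_const[OF assms(6)])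
qed

end
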